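(* Let $G$ be a finite group. The cyclic subgroup graph $\Gamma(G)$ is a tree if and only if $G$ is an EPPO group.
   Context: For a finite group $G$, the cyclic subgroup graph $\Gamma(G)$ is the simple undirected graph whose vertex set is $C(G)$, the set of all cyclic subgroups of $G$ (including the trivial subgroup $\{e\}$), and in which two distinct vertices are adjacent if and only if one of them, $H_1$, is contained in the other, $H_2$, and there is no subgroup $K$ of $G$ with $H_1<K<H_2$ (strict inclusions). An EPPO group is a group all of whose elements have prime power order (the identity, of order $1=p^0$, being allowed). *)

theory Defs
  imports "HOL-Algebra.Elementary_Groups" "HOL-Algebra.Multiplicative_Group"
    "HOL-Computational_Algebra.Primes" "Graph_Theory.Digraph_Component"
begin

definition cyclic_subgroups :: "('a, 'm) monoid_scheme \<Rightarrow> 'a set set" where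
  "cyclic_subgroups G = {H. subgroup H G \<and> cyclic_group (G\<lparr>carrier := H\<rparr>)}"

text \<open>There is no subgroup of \<open>G\<close> (cyclic or not) strictly between \<open>H\<close> and \<open>K\<close>.\<close>

definition covered_by :: "('a, 'm) monoid_scheme \<Rightarrow> 'a set \<Rightarrow> 'a set \<Rightarrow> bool" where
  "covered_by G H K \<longleftrightarrow> H \<subset> K \<and> (\<nexists>L. subgroup L G \<and> H \<subset> L \<and> L \<subset> K)"

text \<open>As usual in \<open>Graph_Theory\<close>, a simple undirected graph is a symmetric loop-free digraph:
  each edge is represented by its two orientations.\<close>

definition cyclic_subgroup_graph ::
    "('a, 'm) monoid_scheme \<Rightarrow> ('a set, 'a set \<times> 'a set) pre_digraph" where
  "cyclic_subgroup_graph G = with_proj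
     \<lparr>pverts = cyclic_subgroups G,
      parcs = {(H, K). H \<in> cyclic_subgroups G \<and> K \<in> cyclic_subgroups G \<and>
                       (covered_by G H K \<or> covered_by G K H)}\<rparr>"

text \<open>The library's \<open>tree\<close> forbids all directed cycles. In a symmetric digraph every edge yields
  a directed cycle \<open>u, v, u\<close>, so that notion does not describe undirected trees. In a simple
  graph the undirected cycles are exactly the (vertex-simple) directed cycles of length at
  least 3.\<close>

definition undirected_tree :: "('a, 'b) pre_digraph \<Rightarrow> bool" where
  "undirected_tree T \<longleftrightarrow>
     graph T \<and> Digraph_Component.connected T \<and>
     (\<nexists>c. pre_digraph.cycle T c \<and> 3 \<le> length c)"

definition eppo_group :: "('a, 'm) monoid_scheme \<Rightarrow> bool" where
  "eppo_group G \<longleftrightarrow>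
     group G \<and>
     (\<forall>x \<in> carrier G. \<exists>(p::nat) n. Factorial_Ring.prime p \<and> group.ord G x = p ^ n)"

lemma graph_cyclic_subgroup_graph:
  assumes "group G" "finite (carrier G)"
  shows "graph (cyclic_subgroup_graph G)"
proof -
  let ?C = "cyclic_subgroups G"
  have "?C \<subseteq> Pow (carrier G)"
    by (auto simp: cyclic_subgroups_def dest: subgroup.subset)
  then have fin: "finite ?C"
    using assms(2) by (meson finite_Pow_iff finite_subset)
  have "finite {(H, K). H \<in> ?C \<and> K \<in> ?C \<and> (covered_by G H K \<or> covered_by G K H)}"
    by (rule finite_subset[of _ "?C \<times> ?C"]) (auto simp: fin)
  with fin show ?thesis
    unfolding cyclic_subgroup_graph_def
    by unfold_locales
      (auto simp: with_proj_def covered_by_def arc_to_ends_def symmetric_def arcs_ends_def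
        image_iff intro!: symI)
qed

lemma (in group) cyclic_subgroups_eq:
  "cyclic_subgroups G = {generate G {x} | x. x \<in> carrier G}"
proof (intro equalityI subsetI)
  fix H assume "H \<in> cyclic_subgroups G"
  then have H: "subgroup H G" and "cyclic_group (G\<lparr>carrier := H\<rparr>)"
    by (auto simp: cyclic_subgroups_def)
  then obtain x where x: "x \<in> H" "subgroup_generated (G\<lparr>carrier := H\<rparr>) {x} = G\<lparr>carrier := H\<rparr>"
    by (auto simp: cyclic_group_def)
  from arg_cong[OF x(2), of carrier] x(1)
  have "generate (G\<lparr>carrier := H\<rparr>) {x} = H"
    by (simp add: subgroup_generated_def)
  moreover have "generate (G\<lparr>carrier := H\<rparr>) {x} = generate G {x}"
    using generate_consistent[OF _ H] x(1) by blast
  moreover have "x \<in> carrier G"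
    using x(1) H by (meson subgroup.mem_carrier)
  ultimately show "H \<in> {generate G {x} | x. x \<in> carrier G}"
    by auto
next
  fix H assume "H \<in> {generate G {x} | x. x \<in> carrier G}"
  then obtain x where x: "x \<in> carrier G" "H = generate G {x}"
    by auto
  then have "G\<lparr>carrier := H\<rparr> = subgroup_generated G {x}"
    by (simp add: subgroup_generated_def)
  moreover have "subgroup H G"
    using x generate_is_subgroup by simp
  ultimately show "H \<in> cyclic_subgroups G"
    using cyclic_group_generated by (simp add: cyclic_subgroups_def)
qed

end

theory Submission
  imports Defs
begin

text \<open>
  An edge of \<open>\<Gamma>(G)\<close> joins two cyclic subgroups one of which covers the other in the subgroup
  lattice. Write \<open>\<langle>x\<rangle>\<close> for the subgroup generated by \<open>x\<close>. If a prime \<open>r\<close> divides the order of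
  \<open>x\<close>, then \<open>\<langle>x\<^sup>r\<rangle>\<close> has index \<open>r\<close> in \<open>\<langle>x\<rangle>\<close>, so \<open>\<langle>x\<rangle>\<close> covers \<open>\<langle>x\<^sup>r\<rangle>\<close> by Lagrange's theorem
  (\<open>covered_by_generate_pow_prime\<close>). Descending along such covers reaches the trivial subgroup,
  so \<open>\<Gamma>(G)\<close> is connected for every finite group \<open>G\<close>.

  If \<open>G\<close> is EPPO, each \<open>x\<close> has prime power order, hence the subgroups of \<open>\<langle>x\<rangle>\<close> form
  a chain, and \<open>\<langle>x\<rangle>\<close> covers at most one subgroup. A cycle of length at least 3 is then impossible: a member of largest cardinality
  would cover both of its neighbours, which are distinct.

  If \<open>G\<close> is not EPPO, some element has an order divisible by two distinct primes \<open>p\<close> and \<open>q\<close>, and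
  a power \<open>y\<close> of it has order \<open>p q\<close>. The subgroups of \<open>\<langle>y\<rangle>\<close> of orders \<open>1\<close>, \<open>p\<close>, \<open>p q\<close>, \<open>q\<close>
  form a cycle of length 4.
\<close>

section \<open>Cycles in a ranked digraph\<close>

text \<open>On a cycle of length at least 3, the predecessor and the successor of a vertex of maximal rank
  are two distinct neighbours of rank at most its own. The hypothesis \<open>unique\<close> excludes this.\<close>

lemma (in wf_digraph) cycle_length_less_3_if_unique_lower_neighbour:
  fixes rank :: "'a \<Rightarrow> nat"
  assumes unique: "\<And>e e'. \<lbrakk>e \<in> arcs G; e' \<in> arcs G; head G e = tail G e';
      rank (tail G e) \<le> rank (head G e); rank (head G e') \<le> rank (tail G e')\<rbrakk>
      \<Longrightarrow> tail G e = head G e'"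
    and "cycle c"
  shows "length c < 3"
proof (rule ccontr)
  assume "\<not> length c < 3"
  define n where "n = length c"
  have n: "3 \<le> n" using \<open>\<not> length c < 3\<close> by (simp add: n_def)
  obtain u where walk: "awalk u c u" and dist: "distinct (tl (awalk_verts u c))" and "c \<noteq> []"
    using \<open>cycle c\<close> by (auto simp: cycle_def)
  have arc: "c ! i \<in> arcs G" if "i < n" for i
    using walk that by (auto simp: awalk_def n_def)
  have cas: "cas u c u" using walk by (auto simp: awalk_def)
  have verts1: "awalk_verts u c = tail G (hd c) # map (head G) c"
    using awalk_verts_conv'[OF cas] \<open>c \<noteq> []\<close> by simp
  have verts2: "awalk_verts u c = map (tail G) c @ [head G (last c)]"
    using \<open>c \<noteq> []\<close> by (simp add: awalk_verts_conv)
  \<comment> \<open>The vertices of the cycle are \<open>w 0, \<dots>, w (n - 1)\<close>; the arc \<open>c ! i\<close> ends at \<open>w i\<close> and starts at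
    its cyclic predecessor.\<close>
  define w where "w i = head G (c ! i)" for i
  have w_inj: "i = j" if "w i = w j" "i < n" "j < n" for i j
    using dist that unfolding verts1 w_def n_def
    by (metis distinct_conv_nth length_map list.sel(3) nth_map)
  have tail_Suc: "tail G (c ! Suc i) = w i" if "Suc i < n" for i
  proof -
    have "awalk_verts u c ! Suc i = w i"
      using that by (simp add: verts1 w_def n_def)
    moreover have "awalk_verts u c ! Suc i = tail G (c ! Suc i)"
      using that by (simp add: verts2 nth_append n_def)
    ultimately show ?thesis by simp
  qed
  have tail_0: "tail G (c ! 0) = w (n - 1)"
  proof -
    have "tail G (hd c) = u" "head G (last c) = u"
      using awhd_if_cas[OF cas, unfolded verts1] awlast_if_cas[OF cas, unfolded verts2] by auto
    then show ?thesis
      using \<open>c \<noteq> []\<close> by (simp add: w_def n_def hd_conv_nth last_conv_nth)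
  qed
  have "\<exists>k. k < n \<and> (\<forall>i<n. rank (w i) \<le> rank (w k))"
  proof -
    have k0: "0 \<in> {..<n}" using n by simp
    have "Max ((\<lambda>i. rank (w i)) ` {..<n}) \<in> (\<lambda>i. rank (w i)) ` {..<n}"
      using k0 by (intro Max_in) auto
    then obtain k where "k < n" "Max ((\<lambda>i. rank (w i)) ` {..<n}) = rank (w k)" by auto
    then show ?thesis by (metis Max_ge finite_imageI finite_lessThan imageI lessThan_iff)
  qed
  then obtain k where k: "k < n" and max: "\<And>i. i < n \<Longrightarrow> rank (w i) \<le> rank (w k)" by blast
  \<comment> \<open>The cyclic predecessor \<open>i\<close> and successor \<open>j\<close> of \<open>k\<close> differ because \<open>n \<ge> 3\<close>.\<close>
  define i where "i = (if k = 0 then n - 1 else k - 1)"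
  define j where "j = (if Suc k = n then 0 else Suc k)"
  have ij: "i < n" "j < n" "i \<noteq> j"
    using k n by (auto simp: i_def j_def)
  have tail_k: "tail G (c ! k) = w i"
    using tail_0 tail_Suc[of "k - 1"] k by (auto simp: i_def)
  have tail_j: "tail G (c ! j) = w k"
    using tail_0 tail_Suc[of k] k by (auto simp: j_def)
  have "tail G (c ! k) = head G (c ! j)"
    using max[OF ij(1)] max[OF ij(2)] tail_k tail_j
    by (intro unique arc k ij) (auto simp: w_def)
  then have "w i = w j" by (simp add: tail_k w_def)
  then show False using w_inj ij by blast
qed

section \<open>Covers of cyclic subgroups\<close>

context group
begin

lemma card_subgroup_dvd:
  assumes "subgroup H G" "subgroup K G" "H \<subseteq> K"
  shows "card H dvd card K"
proof -
  interpret K: group "G\<lparr>carrier := K\<rparr>" using assms by (simp add: subgroup_imp_group)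
  have "subgroup H (G\<lparr>carrier := K\<rparr>)" using assms by (simp add: subgroup_incl)
  from K.lagrange[OF this, symmetric] show ?thesis by (simp add: order_def)
qed

lemma covered_by_if_prime_index:
  assumes "finite (carrier G)" "subgroup H G" "subgroup K G" "H \<subseteq> K"
    and "Factorial_Ring.prime r" "card K = r * card H"
  shows "covered_by G H K"
proof -
  have fin: "finite L" "card L > 0" if "subgroup L G" for L
  proof -
    show "finite L" using assms(1) subgroup.subset[OF that] by (rule rev_finite_subset)
    then show "card L > 0" using subgroup.one_closed[OF that] by (auto simp: card_gt_0_iff)
  qed
  have "r > 1" using assms(5) by (rule prime_gt_1_nat)
  then have "H \<noteq> K" using assms(6) fin(2)[OF assms(2)] by auto
  moreover have False if L: "subgroup L G" "H \<subset> L" "L \<subset> K" for L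
  proof -
    obtain a where a: "card L = card H * a"
      using card_subgroup_dvd[OF assms(2) L(1)] L(2) by (auto elim: dvdE)
    obtain b where b: "card K = card L * b"
      using card_subgroup_dvd[OF L(1) assms(3)] L(3) by (auto elim: dvdE)
    have "r = a * b" using a b assms(6) fin(2)[OF assms(2)] by simp
    then have "a = 1 \<or> b = 1" using assms(5) prime_product by blast
    moreover have "card H < card L" "card L < card K"
      using L fin(1)[OF L(1)] fin(1)[OF assms(3)] by (simp_all add: psubset_card_mono)
    ultimately show False using a b by auto
  qed
  ultimately show ?thesis using assms(4) by (auto simp: covered_by_def)
qed

lemma pow_mem_generate:
  assumes "x \<in> carrier G"
  shows "x [^] (k::nat) \<in> generate G {x}"
  using subgroup_int_pow_closed[OF generate_is_subgroup[of "{x}"] generate.incl[of x], of "int k"] assms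
  by (simp add: int_pow_int)

lemma covered_by_generate_pow_prime:
  assumes "finite (carrier G)" "x \<in> carrier G" "Factorial_Ring.prime r" "r dvd ord x"
  shows "covered_by G (generate G {x [^] r}) (generate G {x})"
proof (rule covered_by_if_prime_index[OF assms(1) _ _ _ assms(3)])
  show sub: "subgroup (generate G {x}) G" "subgroup (generate G {x [^] r}) G"
    using assms(2) by (auto intro!: generate_is_subgroup)
  show "generate G {x [^] r} \<subseteq> generate G {x}"
    using pow_mem_generate[OF assms(2)] sub by (intro generate_subgroup_incl) auto
  have "r \<noteq> 0" using assms(3) by auto
  then show "card (generate G {x}) = r * card (generate G {x [^] r})"
    using assms(2,4) by (simp add: ord_pow flip: generate_pow_card)
qed

text \<open>A power \<open>x\<^sup>i\<close> generates the same subgroup as \<open>x\<^sup>d\<close> for \<open>d = gcd i (ord x)\<close>, which is a power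
  of \<open>p\<close>; of two powers of \<open>p\<close>, one divides the other.\<close>

lemma mem_generate_or_mem_generate_if_prime_power_ord:
  assumes "finite (carrier G)" "x \<in> carrier G" "Factorial_Ring.prime (p::nat)" "ord x = p ^ n"
    and "a \<in> generate G {x}" "b \<in> generate G {x}"
  shows "a \<in> generate G {b} \<or> b \<in> generate G {a}"
proof -
  have mem: "x [^] j \<in> generate G {x [^] i}" if dvd: "gcd i (ord x) dvd j" for i j
  proof -
    \<comment> \<open>By Bezout, \<open>gcd i (ord x)\<close> is a multiple of \<open>i\<close> modulo \<open>ord x\<close>. The natural-number version
      of Bezout's identity needs \<open>i \<noteq> 0\<close>.\<close>
    have "\<exists>s. x [^] gcd i (ord x) = (x [^] i) [^] (s::nat)"
    proof (cases "i = 0")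
      case True
      then show ?thesis using assms(2) by simp
    next
      case False
      then obtain s t where "i * s = ord x * t + gcd i (ord x)"
        using bezout_nat by blast
      then have "(x [^] i) [^] s = (x [^] ord x) [^] t \<otimes> x [^] gcd i (ord x)"
        using assms(2) by (simp add: nat_pow_pow nat_pow_mult del: pow_ord_eq_1)
      then show ?thesis using assms(2) by (metis l_one nat_pow_closed nat_pow_one pow_ord_eq_1)
    qed
    then obtain s :: nat where s: "x [^] gcd i (ord x) = (x [^] i) [^] s" by blast
    obtain t where t: "j = gcd i (ord x) * t" using dvd by (rule dvdE)
    have "x [^] j = (x [^] i) [^] (s * t)"
      unfolding t using assms(2) s by (metis nat_pow_pow nat_pow_closed)
    then show ?thesis using pow_mem_generate assms(2) by simp
  qed
  obtain i j :: nat where ij: "a = x [^] i" "b = x [^] j"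
    using assms(5,6) generate_pow_on_finite_carrier[OF assms(1,2)] by auto
  obtain s where s: "gcd i (ord x) = p ^ s"
    using assms(3,4) by (metis divides_primepow_nat gcd_dvd2)
  obtain t where t: "gcd j (ord x) = p ^ t"
    using assms(3,4) by (metis divides_primepow_nat gcd_dvd2)
  have "gcd i (ord x) dvd gcd j (ord x) \<or> gcd j (ord x) dvd gcd i (ord x)"
    unfolding s t using le_imp_power_dvd nat_le_linear by metis
  then have "gcd i (ord x) dvd j \<or> gcd j (ord x) dvd i"
    by auto
  then show ?thesis using mem ij by blast
qed

lemma covered_by_unique_if_prime_power_ord:
  assumes "finite (carrier G)" "x \<in> carrier G" "Factorial_Ring.prime (p::nat)" "ord x = p ^ n"
    and "subgroup H G" "subgroup K G"
    and "covered_by G H (generate G {x})" "covered_by G K (generate G {x})"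
  shows "H = K"
proof -
  have sub: "H \<subset> generate G {x}" "K \<subset> generate G {x}"
    using assms(7,8) by (auto simp: covered_by_def)
  have "H \<subseteq> K \<or> K \<subseteq> H"
  proof (rule ccontr)
    assume "\<not> (H \<subseteq> K \<or> K \<subseteq> H)"
    then obtain a b where "a \<in> H" "a \<notin> K" "b \<in> K" "b \<notin> H" by blast
    moreover from this have "a \<in> generate G {b} \<or> b \<in> generate G {a}"
      using sub by (intro mem_generate_or_mem_generate_if_prime_power_ord[OF assms(1-4)]) auto
    moreover have "generate G {a} \<subseteq> H" "generate G {b} \<subseteq> K"
      using \<open>a \<in> H\<close> \<open>b \<in> K\<close> assms(5,6) by (simp_all add: generate_subgroup_incl)
    ultimately show False by blast
  qed
  then show ?thesis
    using assms(5-8) sub by (auto simp: covered_by_def)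
qed

end

section \<open>The cyclic subgroup graph\<close>

lemma cyclic_subgroup_graph_simps [simp]:
  "verts (cyclic_subgroup_graph G) = cyclic_subgroups G"
  "arcs (cyclic_subgroup_graph G) = {(H, K). H \<in> cyclic_subgroups G \<and> K \<in> cyclic_subgroups G \<and>
     (covered_by G H K \<or> covered_by G K H)}"
  "tail (cyclic_subgroup_graph G) = fst"
  "head (cyclic_subgroup_graph G) = snd"
  by (simp_all add: cyclic_subgroup_graph_def)

lemma (in group) generate_mem_cyclic_subgroups:
  assumes "x \<in> carrier G"
  shows "generate G {x} \<in> cyclic_subgroups G"
  using assms by (auto simp: cyclic_subgroups_eq)

lemma (in group) connected_cyclic_subgroup_graph:
  assumes "finite (carrier G)"
  shows "Digraph_Component.connected (cyclic_subgroup_graph G)"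
proof -
  let ?T = "cyclic_subgroup_graph G"
  interpret T: graph ?T using graph_cyclic_subgroup_graph[OF is_group assms] .
  have reach: "generate G {x} \<rightarrow>\<^sup>*\<^bsub>?T\<^esub> generate G {\<one>}" if "x \<in> carrier G" for x
    using that
  proof (induction "ord x" arbitrary: x rule: less_induct)
    case less
    show ?case
    proof (cases "ord x = 1")
      case True
      then have "x = \<one>" using less.prems ord_eq_1 by blast
      then show ?thesis using generate_mem_cyclic_subgroups[OF one_closed] by auto
    next
      case False
      then obtain r where r: "Factorial_Ring.prime r" "r dvd ord x"
        using prime_factor_nat by blast
      have "ord x > 0" using assms less.prems by (metis ord_ge_1 One_nat_def Suc_le_eq)
      have "r > 1" using r(1) by (rule prime_gt_1_nat)
      have "ord (x [^] r) = ord x div r"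
        using r less.prems \<open>r > 1\<close> by (intro ord_pow) auto
      then have "ord (x [^] r) < ord x" using \<open>r > 1\<close> \<open>ord x > 0\<close> by simp
      then have IH: "generate G {x [^] r} \<rightarrow>\<^sup>*\<^bsub>?T\<^esub> generate G {\<one>}"
        using less.hyps less.prems by simp
      have "(generate G {x}, generate G {x [^] r}) \<in> arcs ?T"
        using covered_by_generate_pow_prime[OF assms less.prems r] less.prems
        by (auto intro: generate_mem_cyclic_subgroups)
      then have "generate G {x} \<rightarrow>\<^bsub>?T\<^esub> generate G {x [^] r}"
        by (force simp: arcs_ends_conv)
      then show ?thesis using IH by (rule T.adj_reachable_trans)
    qed
  qed
  have "H \<rightarrow>\<^sup>*\<^bsub>?T\<^esub> K" if "H \<in> cyclic_subgroups G" "K \<in> cyclic_subgroups G" for H K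
  proof -
    have "H \<rightarrow>\<^sup>*\<^bsub>?T\<^esub> generate G {\<one>}" "K \<rightarrow>\<^sup>*\<^bsub>?T\<^esub> generate G {\<one>}"
      using that reach by (auto simp: cyclic_subgroups_eq)
    then show ?thesis
      using T.reachable_trans symmetric_reachable[OF T.sym_arcs] by blast
  qed
  moreover have "cyclic_subgroups G \<noteq> {}"
    using generate_mem_cyclic_subgroups[OF one_closed] by blast
  ultimately show ?thesis
    unfolding connected_def strongly_connected_def
    by (auto simp: T.reachable_mk_symmetric_eq[OF T.sym_arcs])
qed

lemma (in group) cycle_length_less_3_if_eppo:
  assumes "finite (carrier G)" "eppo_group G" "pre_digraph.cycle (cyclic_subgroup_graph G) c"
  shows "length c < 3"
proof -
  let ?T = "cyclic_subgroup_graph G"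
  interpret T: graph ?T using graph_cyclic_subgroup_graph[OF is_group assms(1)] .
  have covered: "covered_by G H K"
    if "K \<in> cyclic_subgroups G" "H \<in> cyclic_subgroups G" "covered_by G H K \<or> covered_by G K H"
      "card H \<le> card K" for H K
  proof -
    have "finite H"
      using that(2) assms(1) by (auto simp: cyclic_subgroups_def intro: finite_subset dest: subgroup.subset)
    then have "\<not> K \<subset> H" using that(4) by (meson leD psubset_card_mono)
    then show ?thesis using that(3) by (auto simp: covered_by_def)
  qed
  show ?thesis
  proof (rule T.cycle_length_less_3_if_unique_lower_neighbour[OF _ assms(3), where rank = card])
    fix e e'
    assume e: "e \<in> arcs ?T" "e' \<in> arcs ?T" "head ?T e = tail ?T e'"
      "card (tail ?T e) \<le> card (head ?T e)" "card (head ?T e') \<le> card (tail ?T e')"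
    obtain H K L where [simp]: "e = (H, K)" "e' = (K, L)"
      using e(3) by (cases e; cases e') auto
    have HKL: "H \<in> cyclic_subgroups G" "K \<in> cyclic_subgroups G" "L \<in> cyclic_subgroups G"
      using e(1,2) by auto
    have cov: "covered_by G H K" "covered_by G L K"
      using e HKL by (auto intro: covered)
    obtain x where x: "x \<in> carrier G" "K = generate G {x}"
      using HKL(2) by (auto simp: cyclic_subgroups_eq)
    obtain p :: nat and n where "Factorial_Ring.prime p" "ord x = p ^ n"
      using assms(2) x(1) by (auto simp: eppo_group_def)
    from covered_by_unique_if_prime_power_ord[OF assms(1) x(1) this, of H L]
    have "H = L" using HKL cov x(2) by (auto simp: cyclic_subgroups_def)
    then show "tail ?T e = head ?T e'" by simp
  qed
qed

lemma two_prime_divisors_if_not_prime_power: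
  fixes n :: nat
  assumes "n > 0" "\<nexists>p k. Factorial_Ring.prime (p::nat) \<and> n = p ^ k"
  obtains p q where "Factorial_Ring.prime p" "Factorial_Ring.prime q" "p \<noteq> q" "p * q dvd n"
proof -
  \<comment> \<open>\<open>1 = 2\<^sup>0\<close> counts as a prime power.\<close>
  have "n \<noteq> 1" using assms(2) two_is_prime_nat by (metis power_0)
  then obtain p where p: "Factorial_Ring.prime p" "p dvd n" using prime_factor_nat by blast
  obtain m where m: "n = p ^ multiplicity p n * m" "\<not> p dvd m"
    using assms(1) p(1) multiplicity_decompose'[of n p] by (metis not_prime_unit not_gr_zero)
  have "m \<noteq> 1" using m(1) assms(2) p(1) by (metis mult.right_neutral)
  then obtain q where q: "Factorial_Ring.prime q" "q dvd m" using prime_factor_nat by blast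
  have "p \<noteq> q" using q(2) m(2) by blast
  moreover have "q dvd n" using q(2) m(1) by (metis dvd_mult)
  moreover have "coprime p q" using p(1) q(1) \<open>p \<noteq> q\<close> by (rule primes_coprime)
  ultimately show thesis using that p q(1) divides_mult by blast
qed

lemma (in group) cycle_length_4_if_ord_eq_prime_mult_prime:
  assumes "finite (carrier G)" "y \<in> carrier G" "ord y = p * q"
    and "Factorial_Ring.prime p" "Factorial_Ring.prime q" "p \<noteq> q"
  shows "\<exists>c. pre_digraph.cycle (cyclic_subgroup_graph G) c \<and> length c = 4"
proof -
  let ?T = "cyclic_subgroup_graph G"
  interpret T: graph ?T using graph_cyclic_subgroup_graph[OF is_group assms(1)] .
  have gt1: "p > 1" "q > 1" using assms(4,5) prime_gt_1_nat by blast+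
  have ord: "ord (y [^] q) = p" "ord (y [^] p) = q"
    using assms(2,3) gt1 by (simp_all add: ord_pow)
  have pow: "(y [^] q) [^] p = \<one>" "(y [^] p) [^] q = \<one>"
    using assms(2,3) by (simp_all add: nat_pow_pow mult.commute flip: assms(3))
  define E A B Y where defs: "E = generate G {\<one>}" "A = generate G {y [^] q}"
    "B = generate G {y [^] p}" "Y = generate G {y}"
  have cards: "card E = 1" "card A = p" "card B = q" "card Y = p * q"
    unfolding defs using assms(2,3) ord by (simp_all flip: generate_pow_card)
  have verts: "E \<in> cyclic_subgroups G" "A \<in> cyclic_subgroups G" "B \<in> cyclic_subgroups G"
      "Y \<in> cyclic_subgroups G"
    unfolding defs using assms(2) by (auto intro: generate_mem_cyclic_subgroups)
  have covers: "covered_by G E A" "covered_by G E B" "covered_by G A Y" "covered_by G B Y"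
    unfolding defs
    using covered_by_generate_pow_prime[OF assms(1) _ assms(4), of "y [^] q"]
      covered_by_generate_pow_prime[OF assms(1) _ assms(5), of "y [^] p"]
      covered_by_generate_pow_prime[OF assms(1,2,5)] covered_by_generate_pow_prime[OF assms(1,2,4)]
      assms(2,3) ord pow by auto
  have "p \<noteq> p * q" "q \<noteq> p * q" "1 \<noteq> p * q" using gt1 by auto
  \<comment> \<open>The four subgroups are told apart by their cardinalities.\<close>
  then have "distinct [card E, card A, card B, card Y]"
    unfolding cards using gt1 assms(6) by simp
  then have "distinct [A, Y, B, E]" by auto
  then have "T.cycle [(E, A), (A, Y), (Y, B), (B, E)]"
    using verts covers by (auto simp: T.cycle_def T.awalk_def)
  then show ?thesis by force
qed

lemma (in group) eppo_group_if_undirected_tree: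
  assumes "finite (carrier G)" "undirected_tree (cyclic_subgroup_graph G)"
  shows "eppo_group G"
proof (rule ccontr)
  assume "\<not> eppo_group G"
  then obtain x where x: "x \<in> carrier G"
    and not_pp: "\<nexists>p k. Factorial_Ring.prime (p::nat) \<and> ord x = p ^ k"
    using is_group by (auto simp: eppo_group_def)
  have "ord x > 0" using assms(1) x by (metis ord_ge_1 One_nat_def Suc_le_eq)
  then obtain p q where pq: "Factorial_Ring.prime p" "Factorial_Ring.prime q" "p \<noteq> q"
    "p * q dvd ord x"
    using not_pp by (rule two_prime_divisors_if_not_prime_power)
  then obtain m where m: "ord x = p * q * m" by (auto elim: dvdE)
  then have "ord (x [^] m) = p * q"
    using x \<open>ord x > 0\<close> by (simp add: ord_pow)
  then have "\<exists>c. pre_digraph.cycle (cyclic_subgroup_graph G) c \<and> length c = 4"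
    using assms(1) x pq by (intro cycle_length_4_if_ord_eq_prime_mult_prime) auto
  then show False using assms(2) by (auto simp: undirected_tree_def)
qed

theorem theorem2p6:
  fixes G :: "('a, 'm) monoid_scheme"
  assumes "group G" and "finite (carrier G)"
  shows "undirected_tree (cyclic_subgroup_graph G) \<longleftrightarrow> eppo_group G"
proof -
  interpret group G by fact
  show ?thesis
  proof
    assume "eppo_group G"
    then show "undirected_tree (cyclic_subgroup_graph G)"
      using graph_cyclic_subgroup_graph[OF assms] connected_cyclic_subgroup_graph[OF assms(2)]
        cycle_length_less_3_if_eppo[OF assms(2)]
      by (force simp: undirected_tree_def)
  next
    assume "undirected_tree (cyclic_subgroup_graph G)"
    then show "eppo_group G"
      using eppo_group_if_undirected_tree assms(2) by blast
  qed
qed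

end
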